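(* For any $x\in\mathcal R$ with $\|x\|\succ 0.000000\cdots$, we have $x\otimes x^{-1}\sim 1.000000\cdots$.
   Context: $\mathbb N=\{1,2,3,\dots\}$ and $\mathcal Z_{10}=\{0,1,\dots,9\}$. $\mathcal R$ is the set of all formal decimals $x=x_0.x_1x_2x_3\cdots$ with $x_0\in\mathbb Z$ and $x_k\in\mathcal Z_{10}$ for $k\in\mathbb N$; two elements are equal iff all their digits agree. For $k\in\mathbb N$, $[x]_k=\sum_{i=0}^k x_i10^{-i}\in\mathbb Q$. Order on $\mathcal R$: $x\preceq y$ iff $[x]_k\le [y]_k$ for all $k\in\mathbb N$; $x\prec y$ (equivalently $y\succ x$) means $x\preceq y$ and $x\ne y$. Every nonempty bounded above (below) subset of $(\mathcal R,\preceq)$ has a supremum (infimum). $x\sim y$ ("no gap") means that there is no $z\in\mathcal R\setminus\{x,y\}$ lying strictly between $x$ and $y$ with respect to $\preceq$; $\sim$ is an equivalence relation. $\mathbb Q$ is regarded as a subset of $\mathcal R$ via long division: $\alpha=q/p$ ($p\in\mathbb N$, $q\in\mathbb Z$) is identified with $\alpha_0.\alpha_1\alpha_2\cdots$, where $\alpha_0=\lfloor q/p\rfloor$, $\beta_0=q-\alpha_0p$, $\alpha_{k+1}=\lfloor 10\beta_k/p\rfloor$, $\beta_{k+1}=10\beta_k-\alpha_{k+1}p$. For a bounded sequence $\{x^{(n)}\}_{n\in\mathbb N}$ in $\mathcal R$: $\overline{\mathrm{LIMIT}}(\{x^{(n)}\})=\inf\{\sup\{x^{(k)}: k\ge n\}: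 n\in\mathbb N\}$ and $\underline{\mathrm{LIMIT}}(\{x^{(n)}\})=\sup\{\inf\{x^{(k)}: k\ge n\}: n\in\mathbb N\}$; if they are equal, the common value is denoted $\mathrm{LIMIT}(\{x^{(n)}\})$. It exists for bounded monotone sequences. Additive inverse map: $\Psi(x_0.x_1x_2x_3\cdots)=(-1-x_0).(9-x_1)(9-x_2)(9-x_3)\cdots$; $\Psi^{(k)}$ is the $k$-fold composite of $\Psi$ ($\Psi^{(0)}=\mathrm{id}$). Absolute value: $\|x\|=\max\{x,\Psi(x)\}$ (with respect to $\preceq$). Sign: $\mathrm{sign}(x)=0$ if $x\succeq 0.000000\cdots$ and $\mathrm{sign}(x)=1$ if $x\preceq(-1).999999\cdots$. Multiplication: $x\otimes y=\Psi^{(\mathrm{sign}(x)+\mathrm{sign}(y))}\big(\mathrm{LIMIT}(\{[\|x\|]_k\cdot[\|y\|]_k\}_{k\in\mathbb N})\big)$, the products being taken in $\mathbb Q$. Multiplicative inverse: for $\|x\|\succ 0.000000\cdots$, $x^{-1}=\Psi^{(\mathrm{sign}(x))}\big(\mathrm{LIMIT}(\{1/[\|x\|]_k\}_{k\in\mathbb N})\big)$, where the finitely many initial indices $k$ with $[\|x\|]_k=0$ (for which $1/[\|x\|]_k$ is read as $+\infty$) are disregarded; the remaining terms are rationals, viewed in $\mathcal R$, and form a decreasing sequence bounded below. *)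

theory Defs
  imports Complex_Main
begin

typedef decimal = "{d :: nat \<Rightarrow> int. \<forall>k\<ge>1. d k \<in> {0..9}}"
  morphisms digit Abs_decimal
  by (rule exI[of _ "\<lambda>_. 0"]) simp

lemma digit_range: "k \<ge> 1 \<Longrightarrow> 0 \<le> digit x k \<and> digit x k \<le> 9"
  using digit[of x] by simp

lemma digit_Abs: "(\<And>k. k \<ge> 1 \<Longrightarrow> 0 \<le> d k \<and> d k \<le> 9) \<Longrightarrow> digit (Abs_decimal d) = d"
  by (rule Abs_decimal_inverse) simp

lemma decimal_eqI: "(\<And>k. digit x k = digit y k) \<Longrightarrow> x = y"
  by (metis digit_inject ext)

definition trunc :: "decimal \<Rightarrow> nat \<Rightarrow> rat" where
  "trunc x k = (\<Sum>i=0..k. of_int (digit x i) / 10 ^ i)"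

text \<open>The integer \<open>10 ^ k * trunc x k\<close>; only used in proofs about the order.\<close>

primrec itrunc :: "decimal \<Rightarrow> nat \<Rightarrow> int" where
  "itrunc x 0 = digit x 0"
| "itrunc x (Suc k) = 10 * itrunc x k + digit x (Suc k)"

lemma trunc_itrunc: "trunc x k = of_int (itrunc x k) / 10 ^ k"
  by (induction k) (simp_all add: trunc_def field_simps)

lemma trunc_le_iff: "trunc x k \<le> trunc y k \<longleftrightarrow> itrunc x k \<le> itrunc y k"
  by (simp add: trunc_itrunc divide_le_cancel)

lemma itrunc_step: "10 * itrunc x k \<le> itrunc x (Suc k)" "itrunc x (Suc k) \<le> 10 * itrunc x k + 9"
  using digit_range[of "Suc k" x] by auto

lemma itrunc_le_Suc: "itrunc x (Suc k) \<le> itrunc y (Suc k) \<Longrightarrow> itrunc x k \<le> itrunc y k"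
  using itrunc_step[of x k] itrunc_step[of y k] by linarith

lemma itrunc_eqI:
  assumes "\<And>k. itrunc x k = itrunc y k"
  shows "x = y"
proof (rule decimal_eqI)
  fix k
  show "digit x k = digit y k"
    using assms[of k] assms[of "k - 1"] by (cases k) auto
qed

lemma itrunc_less_mono: "itrunc x k < itrunc y k \<Longrightarrow> itrunc x (k + n) < itrunc y (k + n)"
proof (induction n)
  case (Suc n)
  then show ?case
    using itrunc_step[of x "k + n"] itrunc_step[of y "k + n"] by simp
qed simp

lemma itrunc_le_mono: "itrunc x (k + n) \<le> itrunc y (k + n) \<Longrightarrow> itrunc x k \<le> itrunc y k"
  using itrunc_less_mono[of y k x n] by linarith

instantiation decimal :: linorder
begin

definition less_eq_decimal :: "decimal \<Rightarrow> decimal \<Rightarrow> bool" where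
  "x \<le> y \<longleftrightarrow> (\<forall>k\<ge>1. trunc x k \<le> trunc y k)"

definition less_decimal :: "decimal \<Rightarrow> decimal \<Rightarrow> bool" where
  "x < y \<longleftrightarrow> x \<le> y \<and> x \<noteq> (y :: decimal)"

lemma le_decimal_itrunc: "x \<le> y \<longleftrightarrow> (\<forall>k. itrunc x k \<le> itrunc y k)"
proof
  assume a: "x \<le> y"
  show "\<forall>k. itrunc x k \<le> itrunc y k"
  proof
    fix k
    have "itrunc x (Suc k) \<le> itrunc y (Suc k)"
      using a by (simp add: less_eq_decimal_def trunc_le_iff del: itrunc.simps)
    then show "itrunc x k \<le> itrunc y k" by (rule itrunc_le_Suc)
  qed
qed (simp add: less_eq_decimal_def trunc_le_iff)

instance
proof
  fix x y z :: decimal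
  show antisym: "x \<le> y \<Longrightarrow> y \<le> x \<Longrightarrow> x = y"
    unfolding le_decimal_itrunc by (intro itrunc_eqI) (simp add: order_antisym)
  show "x \<le> x" by (simp add: less_eq_decimal_def)
  show "x \<le> y \<Longrightarrow> y \<le> z \<Longrightarrow> x \<le> z"
    unfolding less_eq_decimal_def by (meson order_trans)
  show "(x < y) = (x \<le> y \<and> \<not> y \<le> x)"
    unfolding less_decimal_def
    by (metis itrunc_eqI le_decimal_itrunc order_antisym)
  show "x \<le> y \<or> y \<le> x"
  proof (rule ccontr)
    assume "\<not> ?thesis"
    then obtain i j where "itrunc y i < itrunc x i" "itrunc x j < itrunc y j"
      by (auto simp: le_decimal_itrunc not_le)
    then show False
      using itrunc_less_mono[of y i x j] itrunc_less_mono[of x j y i]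
      by (simp add: add.commute)
  qed
qed

end

lemma decimal_lub_exists:
  fixes A :: "decimal set"
  assumes ne: "A \<noteq> {}" and bdd: "bdd_above A"
  shows "\<exists>s. (\<forall>x\<in>A. x \<le> s) \<and> (\<forall>u. (\<forall>x\<in>A. x \<le> u) \<longrightarrow> s \<le> u)"
proof -
  obtain u0 where u0: "\<And>x. x \<in> A \<Longrightarrow> x \<le> u0" using bdd by (auto simp: bdd_above_def)
  define M where "M k = Sup ((\<lambda>x. itrunc x k) ` A)" for k
  have bddk: "bdd_above ((\<lambda>x. itrunc x k) ` A)" for k
    using u0 by (intro bdd_aboveI[of _ "itrunc u0 k"]) (auto simp: le_decimal_itrunc)
  have up: "itrunc x k \<le> M k" if "x \<in> A" for x k
    unfolding M_def using that bddk by (intro cSup_upper) auto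
  have att: "\<exists>x\<in>A. M k = itrunc x k" for k
  proof (rule ccontr)
    assume c: "\<not> ?thesis"
    have "M k \<le> M k - 1"
      unfolding M_def[of k] 
    proof (rule cSup_least)
      fix v assume "v \<in> (\<lambda>x. itrunc x k) ` A"
      then obtain x where "x \<in> A" "v = itrunc x k" by auto
      then have "v \<le> M k" "v \<noteq> M k" using up c by auto
      then show "v \<le> Sup ((\<lambda>x. itrunc x k) ` A) - 1" unfolding M_def by simp
    qed (use ne in auto)
    then show False by simp
  qed
  have lo: "10 * M k \<le> M (Suc k)" for k
  proof -
    obtain x where "x \<in> A" "M k = itrunc x k" using att by blast
    then show ?thesis using up[of x "Suc k"] itrunc_step[of x k] by linarith
  qed
  have hi: "M (Suc k) \<le> 10 * M k + 9" for k
  proof -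
    obtain x where "x \<in> A" "M (Suc k) = itrunc x (Suc k)" using att by blast
    then show ?thesis using up[of x k] itrunc_step[of x k] by linarith
  qed
  define s where "s = Abs_decimal (\<lambda>k. case k of 0 \<Rightarrow> M 0 | Suc j \<Rightarrow> M (Suc j) - 10 * M j)"
  have ds: "digit s = (\<lambda>k. case k of 0 \<Rightarrow> M 0 | Suc j \<Rightarrow> M (Suc j) - 10 * M j)"
    unfolding s_def
  proof (rule digit_Abs)
    fix k :: nat assume "k \<ge> 1"
    then obtain j where "k = Suc j" by (cases k) auto
    then show "0 \<le> (case k of 0 \<Rightarrow> M 0 | Suc j \<Rightarrow> M (Suc j) - 10 * M j) \<and>
      (case k of 0 \<Rightarrow> M 0 | Suc j \<Rightarrow> M (Suc j) - 10 * M j) \<le> 9"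
      using lo[of j] hi[of j] by simp
  qed
  have s: "itrunc s k = M k" for k
    by (induction k) (simp_all add: ds)
  show ?thesis
  proof (intro exI[of _ s] conjI ballI allI impI)
    show "x \<le> s" if "x \<in> A" for x using up that by (simp add: le_decimal_itrunc s)
    show "s \<le> u" if "\<forall>x\<in>A. x \<le> u" for u
      unfolding le_decimal_itrunc s
    proof
      fix k
      obtain x where "x \<in> A" "M k = itrunc x k" using att by blast
      then show "M k \<le> itrunc u k" using that by (simp add: le_decimal_itrunc)
    qed
  qed
qed

lemma decimal_glb_exists:
  fixes A :: "decimal set"
  assumes ne: "A \<noteq> {}" and bdd: "bdd_below A"
  shows "\<exists>s. (\<forall>x\<in>A. s \<le> x) \<and> (\<forall>u. (\<forall>x\<in>A. u \<le> x) \<longrightarrow> u \<le> s)"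
proof -
  let ?L = "{l. \<forall>x\<in>A. l \<le> x}"
  have "?L \<noteq> {}" "bdd_above ?L"
    using ne bdd by (auto simp: bdd_below_def bdd_above_def)
  from decimal_lub_exists[OF this] show ?thesis by fast
qed

instantiation decimal :: conditionally_complete_linorder
begin

definition inf_decimal :: "decimal \<Rightarrow> decimal \<Rightarrow> decimal" where "inf_decimal = min"

definition sup_decimal :: "decimal \<Rightarrow> decimal \<Rightarrow> decimal" where "sup_decimal = max"

definition Sup_decimal :: "decimal set \<Rightarrow> decimal" where
  "Sup (A :: decimal set) = (LEAST s. \<forall>x\<in>A. x \<le> s)"

definition Inf_decimal :: "decimal set \<Rightarrow> decimal" where
  "Inf (A :: decimal set) = (GREATEST s. \<forall>x\<in>A. s \<le> x)"

instance
proof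
  fix x y z :: decimal and A :: "decimal set"
  show "inf x y \<le> x" "inf x y \<le> y" "x \<le> sup x y" "y \<le> sup x y"
    "x \<le> y \<Longrightarrow> x \<le> z \<Longrightarrow> x \<le> inf y z" "y \<le> x \<Longrightarrow> z \<le> x \<Longrightarrow> sup y z \<le> x"
    by (auto simp: inf_decimal_def sup_decimal_def)
  have S: "(\<forall>x\<in>A. x \<le> Sup A) \<and> (\<forall>u. (\<forall>x\<in>A. x \<le> u) \<longrightarrow> Sup A \<le> u)"
    if bdd: "A \<noteq> {}" "bdd_above A"
  proof -
    obtain s where s: "\<forall>x\<in>A. x \<le> s" "\<forall>u. (\<forall>x\<in>A. x \<le> u) \<longrightarrow> s \<le> u"
      using decimal_lub_exists[OF bdd] by blast
    have "Sup A = s" unfolding Sup_decimal_def by (rule Least_equality) (use s in auto)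
    then show ?thesis using s by simp
  qed
  have I: "(\<forall>x\<in>A. Inf A \<le> x) \<and> (\<forall>u. (\<forall>x\<in>A. u \<le> x) \<longrightarrow> u \<le> Inf A)"
    if bdd: "A \<noteq> {}" "bdd_below A"
  proof -
    obtain s where s: "\<forall>x\<in>A. s \<le> x" "\<forall>u. (\<forall>x\<in>A. u \<le> x) \<longrightarrow> u \<le> s"
      using decimal_glb_exists[OF bdd] by blast
    have "Inf A = s" unfolding Inf_decimal_def by (rule Greatest_equality) (use s in auto)
    then show ?thesis using s by simp
  qed
  show "x \<in> A \<Longrightarrow> bdd_below A \<Longrightarrow> Inf A \<le> x" using I by auto
  show "A \<noteq> {} \<Longrightarrow> (\<And>x. x \<in> A \<Longrightarrow> z \<le> x) \<Longrightarrow> z \<le> Inf A"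
    using I by (meson bdd_belowI)
  show "x \<in> A \<Longrightarrow> bdd_above A \<Longrightarrow> x \<le> Sup A" using S by auto
  show "A \<noteq> {} \<Longrightarrow> (\<And>x. x \<in> A \<Longrightarrow> x \<le> z) \<Longrightarrow> Sup A \<le> z"
    using S by (meson bdd_aboveI)
qed

end

definition no_gap :: "decimal \<Rightarrow> decimal \<Rightarrow> bool" (infix "\<sim>" 50) where
  "x \<sim> y \<longleftrightarrow> \<not> (\<exists>z. z \<noteq> x \<and> z \<noteq> y \<and> (x \<le> z \<and> z \<le> y \<or> y \<le> z \<and> z \<le> x))"

definition decimal_of_int :: "int \<Rightarrow> decimal" where
  "decimal_of_int n = Abs_decimal (\<lambda>k. if k = 0 then n else 0)"

lemma digit_decimal_of_int: "digit (decimal_of_int n) k = (if k = 0 then n else 0)"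
  unfolding decimal_of_int_def by (subst digit_Abs) auto

text \<open>Long division of \<open>q\<close> by \<open>p > 0\<close>: \<open>div_digit q p k\<close> is \<open>\<alpha>\<^sub>k\<close> and
  \<open>div_rem q p k\<close> is \<open>\<beta>\<^sub>k\<close>.  Note that \<open>div\<close> on \<open>int\<close> rounds down.\<close>

primrec div_rem :: "int \<Rightarrow> int \<Rightarrow> nat \<Rightarrow> int" where
  "div_rem q p 0 = q - (q div p) * p"
| "div_rem q p (Suc k) = 10 * div_rem q p k - ((10 * div_rem q p k) div p) * p"

primrec div_digit :: "int \<Rightarrow> int \<Rightarrow> nat \<Rightarrow> int" where
  "div_digit q p 0 = q div p"
| "div_digit q p (Suc k) = (10 * div_rem q p k) div p"

definition long_division :: "int \<Rightarrow> int \<Rightarrow> decimal" where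
  "long_division q p = Abs_decimal (div_digit q p)"

definition decimal_of_rat :: "rat \<Rightarrow> decimal" where
  "decimal_of_rat r = (case quotient_of r of (q, p) \<Rightarrow> long_division q p)"

lemma div_rem_range: "p > 0 \<Longrightarrow> 0 \<le> div_rem q p k \<and> div_rem q p k < p"
  by (cases k) (simp_all add: minus_div_mult_eq_mod)

lemma digit_long_division:
  assumes "p > 0"
  shows "digit (long_division q p) = div_digit q p"
  unfolding long_division_def
proof (rule digit_Abs)
  fix k :: nat assume "k \<ge> 1"
  then obtain j where k: "k = Suc j" by (cases k) auto
  have r: "0 \<le> div_rem q p j" "div_rem q p j < p" using div_rem_range[OF assms] by auto
  have "(10 * div_rem q p j) div p \<le> (10 * p - 1) div p"
    using r assms by (intro zdiv_mono1) auto
  also have "(10 * p - 1) div p < 10"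
    using assms mult_right_mono[of 10 "(10 * p - 1) div p" p]
    by (smt (verit) minus_mod_eq_div_mult pos_mod_sign)
  finally have "(10 * div_rem q p j) div p < 10" .
  then show "0 \<le> div_digit q p k \<and> div_digit q p k \<le> 9"
    using r assms by (simp add: k pos_imp_zdiv_nonneg_iff)
qed

text \<open>The expansion does not depend on the fraction representing the rational number.\<close>

lemma long_division_scale:
  assumes "c > 0"
  shows "long_division (c * q) (c * p) = long_division q p"
proof -
  have r: "div_rem (c * q) (c * p) k = c * div_rem q p k" for k
  proof (induction k)
    case 0
    then show ?case using assms by (simp add: right_diff_distrib)
  next
    case (Suc k)
    have "10 * (c * div_rem q p k) = c * (10 * div_rem q p k)" by simp
    then show ?case using assms by (simp only: div_rem.simps Suc) (simp add: right_diff_distrib)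
  qed
  have "div_digit (c * q) (c * p) k = div_digit q p k" for k
  proof (cases k)
    case (Suc j)
    have "10 * (c * div_rem q p j) = c * (10 * div_rem q p j)" by simp
    then show ?thesis using assms by (simp only: Suc div_digit.simps r) simp
  qed (use assms in simp)
  then have "div_digit (c * q) (c * p) = div_digit q p" by (rule ext)
  then show ?thesis by (simp add: long_division_def)
qed

lemma decimal_of_rat_Fract:
  assumes "p > 0"
  shows "decimal_of_rat (Fract q p) = long_division q p"
proof -
  have g: "gcd q p > 0" using assms by (simp add: gcd_pos_int)
  have "quotient_of (Fract q p) = (q div gcd q p, p div gcd q p)"
    using assms by (simp add: quotient_of_Fract Rat.normalize_def Let_def)
  then show ?thesis
    using long_division_scale[OF g, of "q div gcd q p" "p div gcd q p"]
    by (simp add: decimal_of_rat_def)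
qed

lemma decimal_of_rat_of_int: "decimal_of_rat (of_int n) = decimal_of_int n"
proof -
  have r: "div_rem n 1 k = 0" for k by (induction k) simp_all
  have "digit (long_division n 1) k = digit (decimal_of_int n) k" for k
    by (cases k) (simp_all add: digit_long_division digit_decimal_of_int r)
  then show ?thesis by (simp add: decimal_of_rat_def decimal_eqI)
qed

text \<open>Sequences are indexed by \<open>1, 2, 3, \<dots>\<close>; the value at index \<open>0\<close> is ignored.\<close>

definition LIMIT_upper :: "(nat \<Rightarrow> decimal) \<Rightarrow> decimal" where
  "LIMIT_upper s = Inf {Sup {s k | k. k \<ge> n} | n. n \<ge> 1}"

definition LIMIT_lower :: "(nat \<Rightarrow> decimal) \<Rightarrow> decimal" where
  "LIMIT_lower s = Sup {Inf {s k | k. k \<ge> n} | n. n \<ge> 1}"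

definition bounded_seq :: "(nat \<Rightarrow> decimal) \<Rightarrow> bool" where
  "bounded_seq s \<longleftrightarrow> bdd_above (s ` {1..}) \<and> bdd_below (s ` {1..})"

text \<open>Unspecified unless the sequence is bounded and its upper and lower limits agree.\<close>

definition LIMIT :: "(nat \<Rightarrow> decimal) \<Rightarrow> decimal" where
  "LIMIT s = (THE l. bounded_seq s \<and> LIMIT_upper s = l \<and> LIMIT_lower s = l)"

definition Psi :: "decimal \<Rightarrow> decimal" where
  "Psi x = Abs_decimal (\<lambda>k. if k = 0 then -1 - digit x 0 else 9 - digit x k)"

lemma digit_Psi: "digit (Psi x) k = (if k = 0 then -1 - digit x 0 else 9 - digit x k)"
  unfolding Psi_def by (subst digit_Abs) (use digit_range[of _ x] in auto)

definition dabs :: "decimal \<Rightarrow> decimal" where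
  "dabs x = max x (Psi x)"

definition dsign :: "decimal \<Rightarrow> nat" where
  "dsign x = (if x \<ge> decimal_of_int 0 then 0 else 1)"

text \<open>The decimal \<open>Psi (decimal_of_int 0)\<close> is \<open>(-1).999\<dots>\<close>.\<close>

lemma dsign_eq_1_iff: "dsign x = 1 \<longleftrightarrow> x \<le> Psi (decimal_of_int 0)"
proof -
  have z: "itrunc (decimal_of_int 0) k = 0" for k
    by (induction k) (simp_all add: digit_decimal_of_int)
  have m: "itrunc (Psi (decimal_of_int 0)) k = -1" for k
    by (induction k) (simp_all add: digit_decimal_of_int digit_Psi)
  have step: "itrunc x (Suc k) < 0 \<longleftrightarrow> itrunc x k < 0" for k
    using itrunc_step[of x k] by linarith
  have "itrunc x k < 0 \<longleftrightarrow> itrunc x 0 < 0" for k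
    by (induction k) (simp_all only: step)
  moreover have "itrunc x k \<le> -1 \<longleftrightarrow> itrunc x k < 0" for k by linarith
  ultimately have "(\<exists>k. itrunc x k < 0) \<longleftrightarrow> (\<forall>k. itrunc x k \<le> -1)" by blast
  moreover have "dsign x = 1 \<longleftrightarrow> (\<exists>k. itrunc x k < 0)"
    unfolding dsign_def le_decimal_itrunc z by (simp del: not_le) (meson not_le)
  ultimately show ?thesis
    by (simp only: le_decimal_itrunc m)
qed

definition dmult :: "decimal \<Rightarrow> decimal \<Rightarrow> decimal" (infixl "\<otimes>" 70) where
  "x \<otimes> y = (Psi ^^ (dsign x + dsign y))
     (LIMIT (\<lambda>k. decimal_of_rat (trunc (dabs x) k * trunc (dabs y) k)))"

text \<open>The truncations of \<open>dabs x\<close> increase with \<open>k\<close>, so those that vanish come first: the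
  sequence defining the inverse is re-indexed to start at the first \<open>k \<ge> 1\<close> with
  \<open>trunc (dabs x) k \<noteq> 0\<close>.  The value is of interest only when \<open>dabs x > 0\<close>.\<close>

definition first_index :: "decimal \<Rightarrow> nat" where
  "first_index x = (LEAST k. k \<ge> 1 \<and> trunc (dabs x) k \<noteq> 0)"

definition dinverse :: "decimal \<Rightarrow> decimal" where
  "dinverse x = (Psi ^^ dsign x)
     (LIMIT (\<lambda>n. decimal_of_rat (1 / trunc (dabs x) (first_index x + (n - 1)))))"

end

theory Submission
  imports Defs
begin

text \<open>Sending a decimal to the real number that it denotes turns \<open>\<sim>\<close> into equality and
  limits of monotone sequences of rationals into real limits. For \<open>a = dabs x\<close>, the limit
  defining the inverse denotes \<open>1 / a\<close>, so the one defining the product denotes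
  \<open>a * (1 / a) = 1\<close>; both factors have the same sign, so \<open>Psi\<close> is applied an even number
  of times and cancels.\<close>

section \<open>The real number denoted by a decimal\<close>

definition real_of_decimal :: "decimal \<Rightarrow> real" where
  "real_of_decimal x = (SUP k. real_of_rat (trunc x k))"

lemma of_rat_trunc: "real_of_rat (trunc x k) = real_of_int (itrunc x k) / 10 ^ k"
  by (simp add: trunc_itrunc of_rat_divide of_rat_power)

text \<open>Only the digit at index 0 can be negative, so every later summand is nonnegative, for
  negative decimals too.\<close>

lemma trunc_mono: "i \<le> j \<Longrightarrow> trunc x i \<le> trunc x j"
  unfolding trunc_def using digit_range[of _ x]
  by (intro sum_mono2) auto

text \<open>The new digit is at most 9, so it adds at most \<open>9 / 10 ^ Suc k\<close>, exactly
  the amount by which the error term shrinks.\<close>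

lemma trunc_upper_Suc:
  "real_of_rat (trunc x (Suc k)) + 1 / 10 ^ Suc k \<le> real_of_rat (trunc x k) + 1 / 10 ^ k"
proof -
  have "real_of_int (itrunc x (Suc k)) + 1 \<le> 10 * (real_of_int (itrunc x k) + 1)"
    using of_int_le_iff[where ?'a = real, THEN iffD2, OF itrunc_step(2)[of x k]]
    by (simp del: itrunc.simps)
  then have "(real_of_int (itrunc x (Suc k)) + 1) / 10 ^ Suc k
      \<le> 10 * (real_of_int (itrunc x k) + 1) / 10 ^ Suc k"
    by (rule divide_right_mono) simp
  then show ?thesis by (simp add: of_rat_trunc add_divide_distrib del: itrunc.simps)
qed

text \<open>Lower bounds increase and upper bounds decrease, so both are compared at the common
  index \<open>max i j\<close>.\<close>

lemma trunc_upper: "real_of_rat (trunc x i) \<le> real_of_rat (trunc x j) + 1 / 10 ^ j"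
proof -
  have d: "decseq (\<lambda>k. real_of_rat (trunc x k) + 1 / 10 ^ k)"
    by (rule decseq_SucI) (rule trunc_upper_Suc)
  have "real_of_rat (trunc x i) \<le> real_of_rat (trunc x (max i j))"
    by (simp add: of_rat_less_eq trunc_mono)
  also have "\<dots> \<le> real_of_rat (trunc x (max i j)) + 1 / 10 ^ max i j" by simp
  also have "\<dots> \<le> real_of_rat (trunc x j) + 1 / 10 ^ j"
    using decseqD[OF d, of j "max i j"] by simp
  finally show ?thesis .
qed

lemma trunc_le_real_of_decimal: "real_of_rat (trunc x k) \<le> real_of_decimal x"
  unfolding real_of_decimal_def
  by (rule cSUP_upper) (auto intro: bdd_aboveI trunc_upper[of x _ 0])

lemma real_of_decimal_le_trunc: "real_of_decimal x \<le> real_of_rat (trunc x k) + 1 / 10 ^ k"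
  unfolding real_of_decimal_def by (rule cSUP_least) (auto intro: trunc_upper)

lemma inverse_power_10_tendsto_0: "(\<lambda>k. 1 / 10 ^ k :: real) \<longlonglongrightarrow> 0"
  using LIMSEQ_inverse_realpow_zero[of 10] by (simp add: inverse_eq_divide)

lemma trunc_tendsto_real_of_decimal: "(\<lambda>k. real_of_rat (trunc x k)) \<longlonglongrightarrow> real_of_decimal x"
proof (rule tendsto_sandwich)
  show "(\<lambda>k. real_of_decimal x - 1 / 10 ^ k) \<longlonglongrightarrow> real_of_decimal x"
    using tendsto_diff[OF tendsto_const inverse_power_10_tendsto_0] by simp
  show "\<forall>\<^sub>F k in sequentially. real_of_decimal x - 1 / 10 ^ k \<le> real_of_rat (trunc x k)"
    using real_of_decimal_le_trunc[of x] by (simp add: diff_le_eq)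
  show "\<forall>\<^sub>F k in sequentially. real_of_rat (trunc x k) \<le> real_of_decimal x"
    by (simp add: trunc_le_real_of_decimal)
qed simp

section \<open>Order of decimals versus order of their real values\<close>

lemma real_of_decimal_mono: "x \<le> y \<Longrightarrow> real_of_decimal x \<le> real_of_decimal y"
  \<comment> \<open>The order compares truncations from index 1 on, hence the threshold 1.\<close>
  by (rule LIMSEQ_le[OF trunc_tendsto_real_of_decimal trunc_tendsto_real_of_decimal])
     (auto simp: less_eq_decimal_def of_rat_less_eq intro: exI[of _ 1])

lemma less_decimal_if_real_of_decimal_less:
  "real_of_decimal x < real_of_decimal y \<Longrightarrow> x < y"
  using real_of_decimal_mono[of y x] by (meson not_le)

text \<open>Multiplied by \<open>10 ^ k\<close>, truncations are integers, so a strict inequality is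
  a gap of at least one unit, and no later digits can undo it.\<close>

lemma trunc_gap:
  assumes "x < y"
  obtains N where "\<And>k. k \<ge> N \<Longrightarrow> real_of_rat (trunc x k) + 1 / 10 ^ k \<le> real_of_rat (trunc y k)"
proof -
  obtain N where N: "itrunc x N < itrunc y N"
    using assms by (auto simp: le_decimal_itrunc not_le simp flip: not_le)
  have "real_of_rat (trunc x k) + 1 / 10 ^ k \<le> real_of_rat (trunc y k)" if "k \<ge> N" for k
  proof -
    have "itrunc x k + 1 \<le> itrunc y k"
      using itrunc_less_mono[OF N, of "k - N"] that by simp
    then have "real_of_int (itrunc x k) + 1 \<le> real_of_int (itrunc y k)" by linarith
    then show ?thesis
      by (simp add: of_rat_trunc add_divide_distrib[symmetric] divide_right_mono)
  qed
  then show thesis by (rule that)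
qed

text \<open>One strict inequality would not suffice: \<open>0.999\<dots> < 1.000\<dots>\<close> denote the same number.\<close>

lemma real_of_decimal_strict_between:
  assumes "x < z" "z < y"
  shows "real_of_decimal x < real_of_decimal y"
proof -
  obtain M where M: "\<And>k. k \<ge> M \<Longrightarrow> real_of_rat (trunc x k) + 1 / 10 ^ k \<le> real_of_rat (trunc z k)"
    using trunc_gap[OF assms(1)] by blast
  obtain N where N: "\<And>k. k \<ge> N \<Longrightarrow> real_of_rat (trunc z k) + 1 / 10 ^ k \<le> real_of_rat (trunc y k)"
    using trunc_gap[OF assms(2)] by blast
  let ?k = "max M N"
  \<comment> \<open>Of the two gaps of size \<open>1 / 10 ^ ?k\<close>, the first absorbs the
    truncation error of \<open>x\<close> and the second gives strictness.\<close>
  have "real_of_decimal x \<le> real_of_rat (trunc z ?k)"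
    using real_of_decimal_le_trunc[of x ?k] M[of ?k] by simp
  also have "\<dots> < real_of_rat (trunc z ?k) + 1 / 10 ^ ?k" by simp
  also have "\<dots> \<le> real_of_decimal y"
    using N[of ?k] trunc_le_real_of_decimal[of y ?k] by simp
  finally show ?thesis .
qed

text \<open>A decimal strictly between the two, in either order, would separate their
  values.\<close>

lemma no_gap_if_real_of_decimal_eq:
  assumes "real_of_decimal x = real_of_decimal y"
  shows "x \<sim> y"
  using assms real_of_decimal_strict_between[of x _ y] real_of_decimal_strict_between[of y _ x]
  unfolding no_gap_def by (metis less_irrefl order_le_imp_less_or_eq)

section \<open>Rationals as decimals: long division and its value\<close>

text \<open>Invariant of long division; with the bounds on the remainder it identifies the digits
  read so far as an integer quotient.\<close>

lemma itrunc_long_division: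
  assumes "p > 0"
  shows "10 ^ k * q = itrunc (long_division q p) k * p + div_rem q p k"
  by (induction k) (simp_all add: digit_long_division[OF assms] algebra_simps)

text \<open>This closed form replaces the digit recursion: monotonicity and value of the embedding
  both follow from properties of the floor.\<close>

lemma itrunc_decimal_of_rat: "itrunc (decimal_of_rat r) k = \<lfloor>r * 10 ^ k\<rfloor>"
proof -
  obtain q p where r: "r = Fract q p" and p: "p > 0" by (cases r)
  have "\<lfloor>r * 10 ^ k\<rfloor> = (10 ^ k * q) div p"
    using p by (simp add: r Fract_of_int_quotient mult.commute
        floor_divide_of_int_eq[symmetric, where ?'a = rat])
  also have "\<dots> = itrunc (long_division q p) k"
    using itrunc_long_division[OF p, of k q] div_rem_range[OF p, of q k] p
    by (simp add: div_pos_pos_trivial)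
  finally show ?thesis using p by (simp add: r decimal_of_rat_Fract)
qed

lemma decimal_of_rat_mono: "r \<le> s \<Longrightarrow> decimal_of_rat r \<le> decimal_of_rat s"
  by (simp add: le_decimal_itrunc itrunc_decimal_of_rat floor_mono mult_right_mono)

lemma real_of_decimal_of_rat: "real_of_decimal (decimal_of_rat r) = real_of_rat r"
proof (rule LIMSEQ_unique[OF trunc_tendsto_real_of_decimal])
  have lo: "trunc (decimal_of_rat r) k \<le> r" for k
    by (simp add: trunc_itrunc itrunc_decimal_of_rat divide_le_eq)
  have "r \<le> trunc (decimal_of_rat r) k + 1 / 10 ^ k" for k
    using floor_correct[of "r * 10 ^ k"]
    by (simp add: trunc_itrunc itrunc_decimal_of_rat field_simps)
  then have "real_of_rat r \<le> real_of_rat (trunc (decimal_of_rat r) k + 1 / 10 ^ k)" for k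
    by (simp only: of_rat_less_eq)
  then have hi: "real_of_rat r - 1 / 10 ^ k \<le> real_of_rat (trunc (decimal_of_rat r) k)" for k
    by (simp add: of_rat_add of_rat_divide of_rat_power diff_le_eq)
  show "(\<lambda>k. real_of_rat (trunc (decimal_of_rat r) k)) \<longlonglongrightarrow> real_of_rat r"
  proof (rule tendsto_sandwich)
    show "(\<lambda>k. real_of_rat r - 1 / 10 ^ k) \<longlonglongrightarrow> real_of_rat r"
      using tendsto_diff[OF tendsto_const inverse_power_10_tendsto_0] by simp
    show "\<forall>\<^sub>F k in sequentially. real_of_rat (trunc (decimal_of_rat r) k) \<le> real_of_rat r"
      using lo by (simp add: of_rat_less_eq)
  qed (use hi in simp_all)
qed

section \<open>\<open>LIMIT\<close> of monotone sequences\<close>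

lemma LIMIT_eqI:
  "bounded_seq s \<Longrightarrow> LIMIT_upper s = l \<Longrightarrow> LIMIT_lower s = l \<Longrightarrow> LIMIT s = l"
  unfolding LIMIT_def by (rule the_equality) auto

text \<open>All tails share one supremum, and each tail has its first term as infimum, so both
  limits reduce to the supremum of the sequence.\<close>

lemma LIMIT_incseq:
  assumes inc: "incseq s" and bdd: "bdd_above (range s)"
  shows "LIMIT s = Sup (range s)"
proof (rule LIMIT_eqI)
  show "bounded_seq s"
    unfolding bounded_seq_def
    using bdd_above_mono[OF bdd image_mono[OF subset_UNIV]] inc
    by (auto intro!: bdd_belowI[of _ "s 0"] simp: incseq_def)
  have tail: "Sup {s k | k. k \<ge> n} = Sup (range s)" for n
  proof (rule antisym)
    show "Sup {s k | k. k \<ge> n} \<le> Sup (range s)"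
      by (rule cSup_subset_mono[OF _ bdd]) auto
    show "Sup (range s) \<le> Sup {s k | k. k \<ge> n}"
    proof (rule cSUP_least)
      fix k
      have "s k \<le> s (max k n)" using inc by (simp add: incseq_def)
      also have "\<dots> \<le> Sup {s k | k. k \<ge> n}"
        by (rule cSup_upper) (auto intro: bdd_above_mono[OF bdd])
      finally show "s k \<le> Sup {s k | k. k \<ge> n}" .
    qed simp
  qed
  have "{Sup (range s) | n :: nat. n \<ge> 1} = {Sup (range s)}" by auto
  then show "LIMIT_upper s = Sup (range s)" by (simp add: LIMIT_upper_def tail)
  have "Inf {s k | k. k \<ge> n} = s n" for n
    using inc by (intro cInf_eq_minimum) (auto simp: incseq_def)
  \<comment> \<open>The lower limit ranges over indices from 1, the range includes
    \<open>s 0\<close>; \<open>tail\<close> at 1 shows that the suprema agree.\<close>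
  then show "LIMIT_lower s = Sup (range s)" by (simp add: LIMIT_lower_def tail[of 1, simplified])
qed

text \<open>Dual to the increasing case, with upper and lower limit exchanged.\<close>

lemma LIMIT_decseq:
  assumes dec: "decseq s" and bdd: "bdd_below (range s)"
  shows "LIMIT s = Inf (range s)"
proof (rule LIMIT_eqI)
  show "bounded_seq s"
    unfolding bounded_seq_def
    using bdd_below_mono[OF bdd image_mono[OF subset_UNIV]] dec
    by (auto intro!: bdd_aboveI[of _ "s 0"] simp: decseq_def)
  have tail: "Inf {s k | k. k \<ge> n} = Inf (range s)" for n
  proof (rule antisym)
    show "Inf (range s) \<le> Inf {s k | k. k \<ge> n}"
      by (rule cInf_superset_mono[OF _ bdd]) auto
    show "Inf {s k | k. k \<ge> n} \<le> Inf (range s)"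
    proof (rule cINF_greatest)
      fix k
      have "Inf {s k | k. k \<ge> n} \<le> s (max k n)"
        by (rule cInf_lower) (auto intro: bdd_below_mono[OF bdd])
      also have "\<dots> \<le> s k" using dec by (simp add: decseq_def)
      finally show "Inf {s k | k. k \<ge> n} \<le> s k" .
    qed simp
  qed
  have "{Inf (range s) | n :: nat. n \<ge> 1} = {Inf (range s)}" by auto
  then show "LIMIT_lower s = Inf (range s)" by (simp add: LIMIT_lower_def tail)
  have "Sup {s k | k. k \<ge> n} = s n" for n
    using dec by (intro cSup_eq_maximum) (auto simp: decseq_def)
  then show "LIMIT_upper s = Inf (range s)" by (simp add: LIMIT_upper_def tail[of 1, simplified])
qed

text \<open>Since \<open>L\<close> may be irrational, the bound comes from a rational beyond
  it.\<close>

lemma bdd_above_decimal_of_rat: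
  assumes "\<And>k. real_of_rat (r k) \<le> L"
  shows "bdd_above (range (\<lambda>k. decimal_of_rat (r k)))"
proof -
  obtain q where "L < real_of_rat q" using of_rat_dense[of L "L + 1"] by auto
  then have "r k \<le> q" for k
    using assms[of k] by (metis less_imp_le of_rat_less order_le_less_trans)
  then show ?thesis by (auto intro!: bdd_aboveI[of _ "decimal_of_rat q"] decimal_of_rat_mono)
qed

lemma bdd_below_decimal_of_rat:
  assumes "\<And>k. L \<le> real_of_rat (r k)"
  shows "bdd_below (range (\<lambda>k. decimal_of_rat (r k)))"
proof -
  obtain q where "real_of_rat q < L" using of_rat_dense[of "L - 1" L] by auto
  then have "q \<le> r k" for k
    using assms[of k] by (metis less_imp_le of_rat_less order_less_le_trans)
  then show ?thesis by (auto intro!: bdd_belowI[of _ "decimal_of_rat q"] decimal_of_rat_mono)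
qed

text \<open>Only the value of the limit is claimed, since a number can have two expansions: the
  terms 0.9, 0.99, ... have supremum 0.999..., not 1.000....\<close>

lemma real_of_decimal_LIMIT_incseq:
  assumes inc: "incseq r" and lim: "(\<lambda>k. real_of_rat (r k)) \<longlonglongrightarrow> L"
  shows "real_of_decimal (LIMIT (\<lambda>k. decimal_of_rat (r k))) = L"
proof -
  let ?s = "\<lambda>k. decimal_of_rat (r k)"
  have le: "real_of_rat (r k) \<le> L" for k
    using incseq_le[OF _ lim] inc by (simp add: incseq_def of_rat_less_eq)
  have bdd: "bdd_above (range ?s)" using le by (rule bdd_above_decimal_of_rat)
  have "incseq ?s" using inc by (simp add: incseq_def decimal_of_rat_mono)
  then have S: "LIMIT ?s = Sup (range ?s)" using bdd by (rule LIMIT_incseq)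
  have "real_of_rat (r k) \<le> real_of_decimal (Sup (range ?s))" for k
    using real_of_decimal_mono[OF cSUP_upper[OF UNIV_I bdd, of k]]
    by (simp add: real_of_decimal_of_rat)
  then have "L \<le> real_of_decimal (Sup (range ?s))" by (intro LIMSEQ_le_const2[OF lim]) auto
  \<comment> \<open>A rational \<open>q\<close> strictly between would bound all terms, forcing the
    value of the supremum down to at most \<open>q\<close>.\<close>
  moreover have "\<not> L < real_of_decimal (Sup (range ?s))"
  proof
    assume "L < real_of_decimal (Sup (range ?s))"
    then obtain q where q: "L < real_of_rat q" "real_of_rat q < real_of_decimal (Sup (range ?s))"
      using of_rat_dense by blast
    have "Sup (range ?s) \<le> decimal_of_rat q"
      using le q(1)
      by (intro cSUP_least decimal_of_rat_mono)
         (auto simp: of_rat_less_eq[where ?'a = real, symmetric]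
           intro: less_imp_le order_le_less_trans)
    then show False
      using real_of_decimal_mono q(2) by (fastforce simp: real_of_decimal_of_rat)
  qed
  ultimately show ?thesis by (simp add: S)
qed

lemma real_of_decimal_LIMIT_decseq:
  assumes dec: "decseq r" and lim: "(\<lambda>k. real_of_rat (r k)) \<longlonglongrightarrow> L"
  shows "real_of_decimal (LIMIT (\<lambda>k. decimal_of_rat (r k))) = L"
proof -
  let ?s = "\<lambda>k. decimal_of_rat (r k)"
  have ge: "L \<le> real_of_rat (r k)" for k
    using decseq_ge[OF _ lim] dec by (simp add: decseq_def of_rat_less_eq)
  have bdd: "bdd_below (range ?s)" using ge by (rule bdd_below_decimal_of_rat)
  have "decseq ?s" using dec by (simp add: decseq_def decimal_of_rat_mono)
  then have I: "LIMIT ?s = Inf (range ?s)" using bdd by (rule LIMIT_decseq)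
  have "real_of_decimal (Inf (range ?s)) \<le> real_of_rat (r k)" for k
    using real_of_decimal_mono[OF cINF_lower[OF bdd UNIV_I, of k]]
    by (simp add: real_of_decimal_of_rat)
  then have "real_of_decimal (Inf (range ?s)) \<le> L" by (intro LIMSEQ_le_const[OF lim]) auto
  moreover have "\<not> real_of_decimal (Inf (range ?s)) < L"
  proof
    assume "real_of_decimal (Inf (range ?s)) < L"
    then obtain q where q: "real_of_decimal (Inf (range ?s)) < real_of_rat q" "real_of_rat q < L"
      using of_rat_dense by blast
    have "decimal_of_rat q \<le> Inf (range ?s)"
      using ge q(2)
      by (intro cINF_greatest decimal_of_rat_mono)
         (auto simp: of_rat_less_eq[where ?'a = real, symmetric]
           intro: less_imp_le order_less_le_trans)
    then show False
      using real_of_decimal_mono q(1) by (fastforce simp: real_of_decimal_of_rat)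
  qed
  ultimately show ?thesis by (simp add: I)
qed

section \<open>\<open>Psi\<close>, sign and absolute value\<close>

lemma Psi_Psi: "Psi (Psi x) = x"
  by (rule decimal_eqI) (simp add: digit_Psi)

lemma Psi_funpow_double: "(Psi ^^ (n + n)) x = x"
  by (induction n) (simp_all add: Psi_Psi)

lemma real_of_decimal_of_int: "real_of_decimal (decimal_of_int n) = of_int n"
  using real_of_decimal_of_rat[of "of_int n"] by (simp add: decimal_of_rat_of_int)

text \<open>Later digits only add a nonnegative amount, and from an integer part of at most -1 they
  cannot climb past (-1).999....\<close>

lemma nonneg_iff_digit_0: "x \<ge> decimal_of_int 0 \<longleftrightarrow> digit x 0 \<ge> 0"
proof
  assume "x \<ge> decimal_of_int 0"
  then have "itrunc (decimal_of_int 0) 0 \<le> itrunc x 0" unfolding le_decimal_itrunc by blast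
  then show "digit x 0 \<ge> 0" by (simp add: digit_decimal_of_int)
next
  assume nn: "digit x 0 \<ge> 0"
  have "itrunc x k \<ge> 0" for k
  proof (induction k)
    case (Suc k)
    then show ?case using itrunc_step(1)[of x k] by linarith
  qed (simp add: nn)
  moreover have "itrunc (decimal_of_int 0) k = 0" for k
    by (induction k) (simp_all add: digit_decimal_of_int)
  ultimately show "x \<ge> decimal_of_int 0" by (simp add: le_decimal_itrunc)
qed

lemma dsign_digit_0: "dsign x = (if digit x 0 \<ge> 0 then 0 else 1)"
  by (simp add: dsign_def nonneg_iff_digit_0)

lemma less_if_digit_0_less: "digit x 0 < digit y 0 \<Longrightarrow> x < y"
  by (metis itrunc.simps(1) le_decimal_itrunc not_le)

text \<open>\<open>Psi\<close> sends an integer part \<open>n\<close> to \<open>-1 - n\<close>,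
  which is negative for nonnegative \<open>n\<close>.\<close>

lemma dabs_eq_if_nonneg:
  assumes "y \<ge> decimal_of_int 0"
  shows "dabs y = y"
proof -
  have "Psi y < y"
    using assms by (intro less_if_digit_0_less) (simp add: nonneg_iff_digit_0 digit_Psi)
  then show ?thesis by (simp add: dabs_def max_absorb1)
qed

lemma dabs_Psi: "dabs (Psi y) = dabs y"
  by (simp add: dabs_def Psi_Psi max.commute)

text \<open>The exponent is 0 or 1, and a single \<open>Psi\<close> makes the integer part of
  \<open>y\<close> negative.\<close>

lemma dsign_funpow_Psi:
  assumes "y \<ge> decimal_of_int 0"
  shows "dsign ((Psi ^^ dsign x) y) = dsign x"
  using assms by (simp add: dsign_digit_0 nonneg_iff_digit_0 digit_Psi)

lemma dabs_funpow_Psi: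
  assumes "y \<ge> decimal_of_int 0"
  shows "dabs ((Psi ^^ n) y) = y"
  using assms by (induction n) (simp_all add: dabs_eq_if_nonneg dabs_Psi)

section \<open>Positivity of truncations and the product with the inverse\<close>

lemma trunc_nonneg: "x \<ge> decimal_of_int 0 \<Longrightarrow> trunc x k \<ge> 0"
  unfolding trunc_def using digit_range[of _ x]
  by (intro sum_nonneg)
     (metis divide_nonneg_nonneg nonneg_iff_digit_0 less_one
        not_le of_int_0_le_iff zero_le_numeral zero_le_power)

text \<open>Strict positivity yields a nonzero truncation at some index from 1 on, so the
  \<open>LEAST\<close> is attained; from there truncations only grow.\<close>

lemma trunc_first_index_pos:
  assumes "dabs x > decimal_of_int 0" and "k \<ge> first_index x"
  shows "trunc (dabs x) k > 0"
proof -
  have nn: "trunc (dabs x) i \<ge> 0" for i using assms(1) by (simp add: trunc_nonneg)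
  have z: "itrunc (decimal_of_int 0) i = 0" for i
    by (induction i) (simp_all add: digit_decimal_of_int)
  obtain N where N: "N \<ge> 1" "trunc (dabs x) N \<noteq> 0"
    using assms(1) unfolding less_le_not_le less_eq_decimal_def
    by (auto simp: trunc_itrunc z)
  then have "trunc (dabs x) (first_index x) \<noteq> 0"
    unfolding first_index_def
    using LeastI[of "\<lambda>k. k \<ge> 1 \<and> trunc (dabs x) k \<noteq> 0" N] by blast
  then have "0 < trunc (dabs x) (first_index x)" using nn[of "first_index x"] by linarith
  also have "\<dots> \<le> trunc (dabs x) k" using assms(2) by (rule trunc_mono)
  finally show ?thesis .
qed

theorem theorem4p14:
  fixes x :: decimal
  assumes "dabs x > decimal_of_int 0"
  shows "x \<otimes> dinverse x \<sim> decimal_of_int 1"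
proof -
  define a where "a = dabs x"
  define K where "K = first_index x"
  \<comment> \<open>Truncated subtraction gives \<open>r 0 = r 1\<close>, so \<open>r\<close> is
    decreasing from index 0 on.\<close>
  define r where "r n = 1 / trunc a (K + (n - 1))" for n
  define y where "y = LIMIT (\<lambda>n. decimal_of_rat (r n))"
  have pos: "trunc a k > 0" if "k \<ge> K" for k
    using trunc_first_index_pos[OF assms] that by (simp add: a_def K_def)
  have a_nn: "trunc a k \<ge> 0" for k using assms by (simp add: a_def trunc_nonneg)
  have a_pos: "real_of_decimal a > 0"
    using pos[of K] trunc_le_real_of_decimal[of a K]
    by (metis order_refl order_less_le_trans zero_less_of_rat_iff)
  have "decseq r"
    unfolding decseq_def r_def
    by (intro allI impI divide_left_mono trunc_mono mult_pos_pos pos) auto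
  moreover have "(\<lambda>n. real_of_rat (r n)) \<longlonglongrightarrow> 1 / real_of_decimal a"
  proof -
    have "filterlim (\<lambda>n. K + (n - 1)) sequentially sequentially"
      by (rule filterlim_at_top_mono[OF filterlim_minus_const_nat_at_top[of 1]]) simp
    from filterlim_compose[OF trunc_tendsto_real_of_decimal this]
    show ?thesis
      unfolding r_def of_rat_divide of_rat_1 using a_pos
      by (intro tendsto_divide tendsto_const) auto
  qed
  ultimately have y: "real_of_decimal y = 1 / real_of_decimal a"
    unfolding y_def by (rule real_of_decimal_LIMIT_decseq)
  \<comment> \<open>Strict positivity of the value is what decides the order: a decimal of value 0
    could also be (-1).999....\<close>
  have "decimal_of_int 0 < y"
    using a_pos by (intro less_decimal_if_real_of_decimal_less) (simp add: y real_of_decimal_of_int)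
  then have y_nn: "decimal_of_int 0 \<le> y" by simp
  have inv: "dinverse x = (Psi ^^ dsign x) y"
    by (simp add: dinverse_def y_def r_def a_def K_def)
  \<comment> \<open>As \<open>y\<close> is nonnegative, \<open>dinverse x\<close> has the sign of
    \<open>x\<close> and absolute value \<open>y\<close>.\<close>
  have prod: "x \<otimes> dinverse x = LIMIT (\<lambda>k. decimal_of_rat (trunc a k * trunc y k))"
    by (simp add: dmult_def inv dsign_funpow_Psi dabs_funpow_Psi y_nn Psi_funpow_double a_def)
  have "incseq (\<lambda>k. trunc a k * trunc y k)"
    unfolding incseq_def using a_nn trunc_nonneg[OF y_nn] by (auto intro!: mult_mono trunc_mono)
  moreover have "(\<lambda>k. real_of_rat (trunc a k * trunc y k)) \<longlonglongrightarrow> real_of_decimal a * real_of_decimal y"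
    unfolding of_rat_mult by (intro tendsto_mult trunc_tendsto_real_of_decimal)
  ultimately have "real_of_decimal (x \<otimes> dinverse x) = real_of_decimal a * real_of_decimal y"
    unfolding prod by (rule real_of_decimal_LIMIT_incseq)
  then show ?thesis
    using a_pos by (intro no_gap_if_real_of_decimal_eq) (simp add: y real_of_decimal_of_int)
qed

end
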